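(* Let $a,b$ be nonnegative integers and define, for $n\ge0$, \[ E_n^{a,b}(q)=[z^n]\left(\cfrac{1}{1-\cfrac{[a+1]_q[b+1]_qz}{1-\cfrac{[a+2]_q[b+2]_qz}{1-\cdots}}}\right). \] Then there is a unique family $\{T_k^{a,b}(q)\}_{k\ge0}$ of functions of $q$ such that for all $n\ge0$, \[ E_n^{a,b}(q)=\frac{1}{(1-q)^{2n}}\sum_{k=0}^{n}\left(\binom{2n}{n-k}-\binom{2n}{n-k-1}\right)q^{k(k+1+a+b)}T_k^{a,b}(q^{-1}). \] Moreover, for all $k\ge0$, $T_k^{a,b}(q)$ is a polynomial in $q$ and \[ T_k^{a,b}(q)\equiv\frac{1}{(q;q)_a(q;q)_b}\cdot\frac{(q;q)_\infty}{(-q;q)_\infty}\pmod{q^k}, \] so that $\lim_{k\to\infty}T_k^{a,b}(q)=\dfrac{1}{(q;q)_a(q;q)_b}\cdot\dfrac{(q;q)_\infty}{(-q;q)_\infty}$ as formal power series in $q$.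
   Context: $[m]_q=(1-q^m)/(1-q)$; $[z^n]$ extracts the coefficient of $z^n$; the continued fraction is a formal power series in $z$. $(x;q)_n=(1-x)(1-xq)\cdots(1-xq^{n-1})$ and $(x;q)_\infty=\prod_{i\ge0}(1-xq^i)$. Binomial coefficients with negative lower index are $0$. *)

theory Defs
  imports
    "HOL-Analysis.Analysis"
    "HOL-Computational_Algebra.Polynomial_FPS"
begin

definition q_int :: "nat \<Rightarrow> 'a::field \<Rightarrow> 'a" where
  "q_int m q = (1 - q ^ m) / (1 - q)"

definition q_poch :: "'a::comm_ring_1 \<Rightarrow> 'a \<Rightarrow> nat \<Rightarrow> 'a" where
  "q_poch x q n = (\<Prod>i<n. 1 - x * q ^ i)"

definition q_poch_inf :: "'a::{t2_space, comm_ring_1} \<Rightarrow> 'a \<Rightarrow> 'a" where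
  "q_poch_inf x q = (\<Prod>i. 1 - x * q ^ i)"

text \<open>Binomial coefficients with an integer lower index; natural-number subtraction
  would turn the lower index \<open>-1\<close> into \<open>0\<close>.\<close>

definition binom_int :: "nat \<Rightarrow> int \<Rightarrow> nat" where
  "binom_int n j = (if j < 0 then 0 else n choose nat j)"

text \<open>\<open>s_convergent c N\<close> is \<open>1/(1 - c 0 z/(1 - c 1 z/( ... /(1 - c (N-1) z))))\<close> as a
  power series in \<open>z\<close>. The infinite continued fraction is the limit of the convergents in the
  usual (\<open>z\<close>-adic) topology on formal power series.\<close>

fun s_convergent :: "(nat \<Rightarrow> 'a::field) \<Rightarrow> nat \<Rightarrow> 'a fps" where
  "s_convergent c 0 = 1"
| "s_convergent c (Suc N) =
     1 / (1 - fps_const (c 0) * fps_X * s_convergent (\<lambda>i. c (Suc i)) N)"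

definition s_fraction :: "(nat \<Rightarrow> 'a::field) \<Rightarrow> 'a fps" where
  "s_fraction c = lim (s_convergent c)"

definition E_ab :: "nat \<Rightarrow> nat \<Rightarrow> nat \<Rightarrow> 'a::field \<Rightarrow> 'a" where
  "E_ab a b n q = fps_nth (s_fraction (\<lambda>i. q_int (a + i + 1) q * q_int (b + i + 1) q)) n"

text \<open>The formula for \<open>E_ab\<close> involves \<open>1/(1 - q)\<close> and \<open>1/q\<close>, so functions of \<open>q\<close> have
  domain \<open>- {0, 1}\<close>, which is closed under \<open>q \<mapsto> 1/q\<close>; membership in \<open>extensional\<close> makes
  equality of such functions mean equality on this domain.\<close>

definition T_family :: "nat \<Rightarrow> nat \<Rightarrow> (nat \<Rightarrow> 'a::field_char_0 \<Rightarrow> 'a) \<Rightarrow> bool" where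
  "T_family a b T \<longleftrightarrow>
     (\<forall>k. T k \<in> extensional (- {0, 1})) \<and>
     (\<forall>n. \<forall>q \<in> - {0, 1}.
        E_ab a b n q = 1 / (1 - q) ^ (2 * n) *
          (\<Sum>k = 0..n.
             (of_nat (binom_int (2 * n) (int n - int k))
                - of_nat (binom_int (2 * n) (int n - int k - 1)))
             * q ^ (k * (k + 1 + a + b)) * T k (1 / q)))"

definition T_limit :: "nat \<Rightarrow> nat \<Rightarrow> 'a::field fps" where
  "T_limit a b =
     1 / (q_poch fps_X fps_X a * q_poch fps_X fps_X b)
       * (q_poch_inf fps_X fps_X / q_poch_inf (- fps_X) fps_X)"

text \<open>The limits used above exist.\<close>

lemma s_convergent_stable:
  "n \<le> N \<Longrightarrow> fps_nth (s_convergent c (Suc N)) n = fps_nth (s_convergent c N) n"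
proof (induction N arbitrary: c n)
  case 0
  then show ?case by (simp add: fps_divide_unit)
next
  case (Suc N)
  let ?c = "\<lambda>i. c (Suc i)"
  define f where "f = 1 - fps_const (c 0) * fps_X * s_convergent ?c (Suc N)"
  define g where "g = 1 - fps_const (c 0) * fps_X * s_convergent ?c N"
  have f0: "fps_nth f 0 \<noteq> 0" and g0: "fps_nth g 0 \<noteq> 0"
    by (simp_all add: f_def g_def mult.assoc)
  have fg: "fps_nth (g - f) i = 0" if "i \<le> Suc N" for i
    using that Suc.IH[of "i - 1" ?c]
    by (cases i) (auto simp: f_def g_def mult.assoc simp del: s_convergent.simps)
  have "inverse f - inverse g = inverse f * inverse g * (g - f)"
  proof -
    have "inverse f * f = 1" "inverse g * g = 1"
      using f0 g0 by (simp_all add: inverse_mult_eq_1)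
    then have "inverse f - inverse g = inverse f * (inverse g * g) - (inverse f * f) * inverse g"
      by (simp only: mult_1_left mult_1_right)
    also have "\<dots> = inverse f * inverse g * (g - f)"
      by (simp only: right_diff_distrib mult_ac)
    finally show ?thesis .
  qed
  then have "fps_nth (inverse f - inverse g) n = 0"
    using fg Suc.prems by (simp only: fps_mult_nth) (auto intro!: sum.neutral)
  then have "fps_nth (1 / f) n = fps_nth (1 / g) n"
    using f0 g0 by (simp add: fps_divide_unit)
  moreover have "s_convergent c (Suc (Suc N)) = 1 / f" "s_convergent c (Suc N) = 1 / g"
    unfolding f_def g_def by (simp_all only: s_convergent.simps)
  ultimately show ?case by simp
qed

lemma s_convergent_tendsto: "s_convergent c \<longlonglongrightarrow> s_fraction c"
proof -
  have *: "fps_nth (s_convergent c N) n = fps_nth (s_convergent c n) n" if "n \<le> N" for n N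
    using that by (induction N rule: dec_induct) (simp_all del: s_convergent.simps add: s_convergent_stable)
  have "s_convergent c \<longlonglongrightarrow> Abs_fps (\<lambda>n. fps_nth (s_convergent c n) n)"
    by (rule tendsto_fpsI, rule eventually_sequentiallyI, unfold fps_nth_Abs_fps, erule *)
  then show ?thesis
    by (simp add: s_fraction_def limI)
qed

lemma q_poch_inf_fps:
  fixes x :: "'a::field fps"
  assumes "fps_nth x 0 = 0"
  shows "(\<lambda>i. 1 - x * fps_X ^ i) has_prod q_poch_inf x fps_X"
    and "fps_nth (q_poch_inf x fps_X) 0 = 1"
proof -
  define P where "P n = (\<Prod>i\<le>n. 1 - x * fps_X ^ i)" for n
  have step: "fps_nth (P (Suc N)) n = fps_nth (P N) n" if "n \<le> N" for n N
  proof -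
    have "P (Suc N) = P N - fps_X ^ Suc N * (P N * x)"
      by (simp add: P_def algebra_simps)
    then show ?thesis using that by (simp add: fps_X_power_mult_nth del: power_Suc)
  qed
  have *: "fps_nth (P N) n = fps_nth (P n) n" if "n \<le> N" for n N
    using that by (induction N rule: dec_induct) (simp_all add: step)
  define L where "L = Abs_fps (\<lambda>n. fps_nth (P n) n)"
  have lim: "P \<longlonglongrightarrow> L"
    unfolding L_def by (rule tendsto_fpsI, rule eventually_sequentiallyI, unfold fps_nth_Abs_fps, erule *)
  have L0: "fps_nth L 0 = 1"
    using assms by (simp add: L_def P_def)
  then have "L \<noteq> 0" by auto
  then have has: "(\<lambda>i. 1 - x * fps_X ^ i) has_prod L"
    using lim unfolding has_prod_def raw_has_prod_def P_def by simp
  have "L = q_poch_inf x fps_X"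
    unfolding q_poch_inf_def prodinf_def
  proof (rule the_equality[symmetric], rule has)
    fix p assume "(\<lambda>i. 1 - x * fps_X ^ i) has_prod p"
    moreover have "1 - x * fps_X ^ i \<noteq> 0" for i
    proof
      assume "1 - x * fps_X ^ i = 0"
      then have "fps_nth (1 - x * fps_X ^ i) 0 = 0" by simp
      then show False using assms by simp
    qed
    ultimately have "P \<longlonglongrightarrow> p"
      unfolding has_prod_def raw_has_prod_def P_def by auto
    then show "p = L" using lim LIMSEQ_unique by blast
  qed
  with has L0 show "(\<lambda>i. 1 - x * fps_X ^ i) has_prod q_poch_inf x fps_X"
    and "fps_nth (q_poch_inf x fps_X) 0 = 1" by simp_all
qed

end

theory Submission
  imports Defs
begin

text \<open>
  Put \<open>U_k(q) = q^{k(k+1+a+b)} T_k(1/q)\<close>. If \<open>w = z (1 + w)\<^sup>2\<close>, the ballot numbers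
  \<open>binom(2n, n-k) - binom(2n, n-k-1)\<close> have generating function \<open>(1 + w) w^k\<close> in \<open>z\<close>, so the
  functional equation of the continued fraction becomes a convolution recurrence for the \<open>U_k\<close>.
  Written for \<open>T_k\<close>, with \<open>A = q^a\<close> and \<open>B = q^b\<close>, it reads
  \<open>T_{k+1}(A,B) + q^{2k+2} A B T_k(A,B) = (1-qA)(1-qB) \<Sum>_{i+j=k} q^{2i(j+1)} T_i(A,B) T_j(qA,qB)\<close>,
  which makes \<open>T_k\<close> a polynomial. Only the term \<open>i = 0\<close> survives modulo \<open>q^{k+1}\<close>. Replacing
  \<open>A, B\<close> by \<open>t A, t B\<close> for an indeterminate \<open>t\<close>, the shift \<open>t \<mapsto> q t\<close> gains a factor \<open>q\<close> on every
  error term without constant coefficient, and this gives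
  \<open>T_k(A,B) \<equiv> T_k(0,0) \<Prod>_{i=1}^k (1-q^i A)(1-q^i B)\<close> modulo \<open>q^k\<close>. Finally \<open>T_k(0,0)\<close> is a
  \<open>q\<^sup>2\<close>-Catalan number with limit \<open>1/(q\<^sup>2;q\<^sup>2)_\<infinity> = 1/((q;q)_\<infinity> (-q;q)_\<infinity>)\<close>.
\<close>

section \<open>The polynomial recurrence\<close>

text \<open>\<open>A\<close> and \<open>B\<close> stand for q^a and q^b. Left free, they turn the
  step from (a, b) to (a+1, b+1) into multiplication by q, and they can also be set to 0. A general
  ring lets one recursion serve field values, polynomials and power series.\<close>

fun T_gen :: "'r::comm_ring_1 \<Rightarrow> 'r \<Rightarrow> 'r \<Rightarrow> nat \<Rightarrow> 'r" where
  "T_gen q A B 0 = 1"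
| "T_gen q A B (Suc k) =
     (1 - q * A) * (1 - q * B) *
       (\<Sum>i\<le>k. q ^ (2 * i * (k - i + 1)) * T_gen q A B i * T_gen q (q * A) (q * B) (k - i))
     - q ^ (2 * k + 2) * A * B * T_gen q A B k"

declare T_gen.simps(2) [simp del]

text \<open>The recursion uses ring operations only. The maps needed later are evaluation of
  polynomials, the substitution t -> q t, and the embedding of polynomials into power
  series.\<close>

lemma T_gen_hom:
  fixes h :: "'r::comm_ring_1 \<Rightarrow> 's::comm_ring_1"
  assumes one: "h 1 = 1"
    and diff: "\<And>x y. h (x - y) = h x - h y"
    and mult: "\<And>x y. h (x * y) = h x * h y"
  shows "h (T_gen q A B k) = T_gen (h q) (h A) (h B) k"
proof -
  have zero: "h 0 = 0"
    using diff[of 0 0] by simp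
  have add: "h (x + y) = h x + h y" for x y
    using diff[of x "0 - y"] diff[of 0 y] zero by simp
  have sum: "h (sum f S) = (\<Sum>x\<in>S. h (f x))" for f :: "nat \<Rightarrow> 'r" and S
    using sum_comp_morphism[of h f S] zero add by (simp add: o_def)
  have power: "h (x ^ n) = h x ^ n" for x n
    by (induction n) (simp_all add: one mult)
  show ?thesis
  proof (induction k arbitrary: A B rule: less_induct)
    case (less k)
    show ?case
    proof (cases k)
      case 0
      then show ?thesis by (simp add: one)
    next
      case (Suc m)
      have "h (T_gen q A B i) = T_gen (h q) (h A) (h B) i"
        "h (T_gen q (q * A) (q * B) i) = T_gen (h q) (h q * h A) (h q * h B) i" if "i \<le> m" for i
        using less.IH[of i] that Suc by (simp_all add: mult)
      then show ?thesis
        by (simp add: Suc T_gen.simps(2) one diff mult sum power)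
    qed
  qed
qed

section \<open>The case A = B = 0: Carlitz-Riordan Catalan numbers in q^2\<close>

lemma T_gen_zero_Suc:
  "T_gen q 0 0 (Suc k) = (\<Sum>i\<le>k. q ^ (2 * i * (k - i + 1)) * T_gen q 0 0 i * T_gen q 0 0 (k - i))"
  by (simp add: T_gen.simps(2))

text \<open>The intended \<open>g n\<close> is 1/(q^2;q^2)_n. Expanding each factor
  \<open>T_gen q 0 0 (m - n)\<close> with n < m by its recurrence and regrouping by p = n + i makes
  the inner sum the induction hypothesis at p, and the remaining sum the one at m - 1.\<close>

lemma T_gen_zero_convolution:
  fixes q :: "'r::comm_ring_1" and g :: "nat \<Rightarrow> 'r"
  assumes "g 0 = 1" and g: "\<And>m. (1 - q ^ (2 * Suc m)) * g (Suc m) = g m"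
  shows "(\<Sum>n\<le>m. q ^ (2 * n * (m - n + 1)) * g n * T_gen q 0 0 (m - n)) = g m"
proof (induction m rule: less_induct)
  case (less m)
  show ?case
  proof (cases m)
    case 0
    then show ?thesis using assms by simp
  next
    case (Suc l)
    let ?C = "T_gen q 0 0"
    have "(\<Sum>n\<le>l. q ^ (2 * n * (m - n + 1)) * g n * ?C (m - n)) =
      (\<Sum>n\<le>l. \<Sum>i\<le>l - n. q ^ (2 * n * (m - n + 1) + 2 * i * (l - n - i + 1)) * g n * ?C i * ?C (l - n - i))"
    proof (rule sum.cong[OF refl])
      fix n assume "n \<in> {..l}"
      then have "m - n = Suc (l - n)" using Suc by simp
      then show "q ^ (2 * n * (m - n + 1)) * g n * ?C (m - n) =
        (\<Sum>i\<le>l - n. q ^ (2 * n * (m - n + 1) + 2 * i * (l - n - i + 1)) * g n * ?C i * ?C (l - n - i))"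
        by (simp add: T_gen_zero_Suc sum_distrib_left power_add mult_ac del: mult_Suc mult_Suc_right)
    qed
    also have "\<dots> = (\<Sum>(n, i)\<in>(SIGMA n:{..l}. {..l - n}).
        q ^ (2 * n * (m - n + 1) + 2 * i * (l - n - i + 1)) * g n * ?C i * ?C (l - n - i))"
      by (subst sum.Sigma) auto
    also have "\<dots> = (\<Sum>(p, n)\<in>(SIGMA p:{..l}. {..p}).
        q ^ (2 * p * (l - p + 1)) * ?C (l - p) * (q ^ (2 * n * (p - n + 1)) * g n * ?C (p - n)))"
    proof (rule sum.reindex_bij_witness[of _ "\<lambda>(p, n). (n, p - n)" "\<lambda>(n, i). (n + i, n)"], goal_cases)
      case (5 x)
      obtain n i where x: "x = (n, i)" by force
      with 5 have "n + i \<le> l" by auto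
      then obtain j where j: "l = n + i + j" using le_Suc_ex by blast
      \<comment> \<open>With j = l - n - i, the exponent splits into the outer weight of p = n + i
        and the inner weight of n within p.\<close>
      have "2 * n * (i + j + 2) + 2 * i * (j + 1) = 2 * (n + i) * (j + 1) + 2 * n * (i + 1)"
        by (simp add: algebra_simps)
      moreover have "m - n + 1 = i + j + 2" using Suc j by simp
      ultimately have "q ^ (2 * n * (m - n + 1) + 2 * i * (j + 1)) =
          q ^ (2 * (n + i) * (j + 1)) * q ^ (2 * n * (i + 1))"
        by (simp only: power_add[symmetric])
      moreover have "l - n - i = j" "l - (n + i) = j" "n + i - n = i" using j by simp_all
      ultimately show ?case
        unfolding x prod.case by (simp only: mult_ac)
    qed auto
    also have "\<dots> = (\<Sum>p\<le>l. \<Sum>n\<le>p.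
        q ^ (2 * p * (l - p + 1)) * ?C (l - p) * (q ^ (2 * n * (p - n + 1)) * g n * ?C (p - n)))"
      by (subst sum.Sigma) auto
    also have "\<dots> = (\<Sum>p\<le>l. q ^ (2 * p * (l - p + 1)) * ?C (l - p) * g p)"
      using less.IH Suc by (simp add: sum_distrib_left[symmetric])
    also have "\<dots> = g l"
      using less.IH[of l] Suc by (simp add: mult_ac)
    \<comment> \<open>The regrouped sum ran up to l = m - 1; the summand n = m adds q^(2m) g(m),
      which the recursion of \<open>g\<close> absorbs.\<close>
    finally have "(\<Sum>n\<le>m. q ^ (2 * n * (m - n + 1)) * g n * ?C (m - n)) = g l + q ^ (2 * m) * g m"
      by (simp add: Suc)
    also have "\<dots> = g m"
      using g[of l] Suc by (simp add: algebra_simps)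
    finally show ?thesis .
  qed
qed

section \<open>Congruences modulo powers of q\<close>

lemma T_gen_Suc_cong:
  "q ^ Suc k dvd T_gen q A B (Suc k) - (1 - q * A) * (1 - q * B) * T_gen q (q * A) (q * B) k"
proof -
  let ?f = "\<lambda>i. q ^ (2 * i * (k - i + 1)) * T_gen q A B i * T_gen q (q * A) (q * B) (k - i)"
  have "q ^ Suc k dvd ?f i" if i: "i \<in> {..k} - {0}" for i
  proof -
    obtain i' j where "i = Suc i'" "k = i + j"
      using i by (metis DiffD1 DiffD2 atMost_iff insertI1 le_Suc_ex not0_implies_Suc)
    \<comment> \<open>With k = i + j and i \<ge> 1, this is i + j + 1 \<le> 2 i (j + 1).\<close>
    then have "Suc k \<le> 2 * i * (k - i + 1)"
      by (simp add: algebra_simps)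
    then show ?thesis
      by (simp only: mult.assoc le_imp_power_dvd dvd_mult2)
  qed
  then have "q ^ Suc k dvd (1 - q * A) * (1 - q * B) * sum ?f ({..k} - {0})"
    using dvd_sum[of "{..k} - {0}" "q ^ Suc k" ?f] by (intro dvd_mult) blast
  moreover have "q ^ Suc k dvd q ^ (2 * k + 2) * A * B * T_gen q A B k"
    by (simp only: mult.assoc) (intro dvd_mult2 le_imp_power_dvd, simp)
  moreover have "T_gen q A B (Suc k) - (1 - q * A) * (1 - q * B) * T_gen q (q * A) (q * B) k =
      (1 - q * A) * (1 - q * B) * sum ?f ({..k} - {0}) - q ^ (2 * k + 2) * A * B * T_gen q A B k"
    by (simp add: T_gen.simps(2) sum.remove[of "{..k}" 0] algebra_simps)
  ultimately show ?thesis
    by (simp only: dvd_diff)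
qed

text \<open>A direct induction falls one power short: the hypothesis at (qA, qB) gives only q^k.
  Marking A and B by a variable t makes this shift the substitution t -> q t; the error vanishes at
  t = 0, so the substitution supplies the missing factor. Setting t = 1 at the end returns to A and
  B.\<close>

lemma T_gen_cong_product:
  fixes q A B :: "'r::idom"
  assumes "q \<noteq> 0"
  shows "q ^ k dvd T_gen q A B k - T_gen q 0 0 k * (\<Prod>i<k. (1 - q ^ Suc i * A) * (1 - q ^ Suc i * B))"
proof -
  define Q where "Q = [:q:]"
  define a where "a = [:0, A:]"
  define b where "b = [:0, B:]"
  define D where "D k = T_gen Q a b k - T_gen Q 0 0 k * (\<Prod>i<k. (1 - Q ^ Suc i * a) * (1 - Q ^ Suc i * b))" for k
  define \<sigma> where "\<sigma> p = pcompose p [:0, q:]" for p :: "'r poly"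
  have \<sigma>_simps: "\<sigma> 1 = 1" "\<sigma> Q = Q" "\<sigma> a = Q * a" "\<sigma> b = Q * b" "\<sigma> 0 = 0"
    "\<sigma> (x - y) = \<sigma> x - \<sigma> y" "\<sigma> (x * y) = \<sigma> x * \<sigma> y" for x y
    by (simp_all add: \<sigma>_def Q_def a_def b_def pcompose_1 pcompose_diff pcompose_mult pcompose_pCons mult.commute)
  have \<sigma>_power: "\<sigma> (x ^ n) = \<sigma> x ^ n" for x n
    by (induction n) (simp_all add: \<sigma>_simps)
  have \<sigma>_T: "\<sigma> (T_gen x y z n) = T_gen (\<sigma> x) (\<sigma> y) (\<sigma> z) n" for x y z n
    by (rule T_gen_hom) (simp_all add: \<sigma>_simps)
  have poly_T: "poly (T_gen x y z n) t = T_gen (poly x t) (poly y t) (poly z t) n" for x y z :: "'r poly" and n t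
    by (rule T_gen_hom) simp_all
  have D0: "poly (D n) 0 = 0" for n
    by (simp add: D_def poly_T poly_prod Q_def a_def b_def)
  have "Q ^ k dvd D k"
  proof (induction k)
    case 0
    then show ?case by simp
  next
    case (Suc k)
    let ?u = "(1 - Q * a) * (1 - Q * b)"
    obtain R where R: "D k = Q ^ k * R"
      using Suc.IH by blast
    \<comment> \<open>At t = 0 the relation reads q^k R(0) = 0, and q^k cancels. So t divides R, and
      \<sigma> sends t to q t.\<close>
    have "poly R 0 = 0"
      using D0[of k] assms by (simp add: R Q_def)
    then obtain R' where "R = [:0, 1:] * R'"
      by (metis dvdE poly_eq_0_iff_dvd minus_zero)
    moreover have "\<sigma> [:0, 1:] = Q * [:0, 1:]"
      by (simp add: \<sigma>_def Q_def pcompose_pCons)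
    ultimately have "\<sigma> (D k) = Q ^ Suc k * ([:0, 1:] * \<sigma> R')"
      by (simp only: R \<sigma>_simps \<sigma>_power power_Suc mult_ac)
    then have 1: "Q ^ Suc k dvd \<sigma> (D k)"
      by (rule dvdI)
    define M where "M n = (\<Prod>i<n. (1 - Q ^ Suc i * a) * (1 - Q ^ Suc i * b))" for n
    have "\<sigma> (M n) = (\<Prod>i<n. (1 - Q ^ Suc (Suc i) * a) * (1 - Q ^ Suc (Suc i) * b))" for n
      by (induction n) (simp_all add: M_def \<sigma>_simps \<sigma>_power mult_ac)
    then have M: "M (Suc k) = ?u * \<sigma> (M k)"
      unfolding M_def by (subst prod.lessThan_Suc_shift) simp
    have \<sigma>D: "\<sigma> (D k) = T_gen Q (Q * a) (Q * b) k - T_gen Q 0 0 k * \<sigma> (M k)"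
      unfolding D_def M_def[symmetric] by (simp only: \<sigma>_simps \<sigma>_T)
    have 2: "Q ^ Suc k dvd T_gen Q 0 0 (Suc k) - T_gen Q 0 0 k"
      using T_gen_Suc_cong[of Q k 0 0] by simp
    \<comment> \<open>Three errors: one recurrence step, the shifted inductive error, and the change
      from T_k(0,0) to T_(k+1)(0,0).\<close>
    have "D (Suc k) = (T_gen Q a b (Suc k) - ?u * T_gen Q (Q * a) (Q * b) k) + ?u * \<sigma> (D k)
        - (T_gen Q 0 0 (Suc k) - T_gen Q 0 0 k) * M (Suc k)"
      unfolding \<sigma>D M unfolding D_def M_def[symmetric] M by (simp add: algebra_simps)
    then show ?case
      using T_gen_Suc_cong[of Q k a b] 1 2 by (simp only: dvd_add dvd_diff dvd_mult dvd_mult2)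
  qed
  then have "poly (Q ^ k) 1 dvd poly (D k) 1"
    by (metis dvdE dvdI poly_mult)
  then show ?thesis
    by (simp add: D_def poly_T poly_prod Q_def a_def b_def mult_ac)
qed

section \<open>Comparison with the limit\<close>

lemma fps_X_power_dvd_iff:
  fixes f :: "'a::comm_ring_1 fps"
  shows "fps_X ^ k dvd f \<longleftrightarrow> (\<forall>n<k. fps_nth f n = 0)"
proof
  assume "fps_X ^ k dvd f"
  then show "\<forall>n<k. fps_nth f n = 0"
    by (auto simp: fps_X_power_mult_nth)
next
  assume "\<forall>n<k. fps_nth f n = 0"
  then have "f = fps_X ^ k * fps_shift k f"
    by (intro fps_ext) (simp add: fps_X_power_mult_nth)
  then show "fps_X ^ k dvd f" by (rule dvdI)
qed

lemma q_poch_Suc: "q_poch x q (Suc n) = q_poch x q n * (1 - x * q ^ n)"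
  by (simp add: q_poch_def)

lemma fps_nth_q_poch_0: "fps_nth x 0 = 0 \<Longrightarrow> fps_nth (q_poch x fps_X n) 0 = 1"
  by (induction n) (simp_all add: q_poch_Suc, simp add: q_poch_def)

text \<open>Each factor beyond the first n changes the product only by a multiple of X^n.\<close>

lemma q_poch_cong_inf:
  fixes x :: "'a::field fps"
  assumes x: "fps_nth x 0 = 0" and "k \<le> n"
  shows "fps_X ^ k dvd q_poch x fps_X n - q_poch_inf x fps_X"
proof -
  have stable: "fps_nth (q_poch x fps_X N) m = fps_nth (q_poch x fps_X n) m" if "n \<le> N" "m < k" for N m
    using that(1)
  proof (induction N rule: dec_induct)
    case (step N)
    have "q_poch x fps_X (Suc N) = q_poch x fps_X N - fps_X ^ N * (q_poch x fps_X N * x)"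
      by (simp add: q_poch_Suc algebra_simps)
    then show ?case
      using step that assms(2) by (simp add: fps_X_power_mult_nth)
  qed simp
  \<comment> \<open>\<open>has_prod\<close> allows partial products to start after a zero factor;
    without zero factors they start at index 0.\<close>
  have "1 - x * fps_X ^ i \<noteq> 0" for i
  proof
    assume "1 - x * fps_X ^ i = 0"
    then have "fps_nth (1 - x * fps_X ^ i) 0 = 0" by simp
    then show False using x by simp
  qed
  then have "(\<lambda>N. \<Prod>i\<le>N. 1 - x * fps_X ^ i) \<longlonglongrightarrow> q_poch_inf x fps_X"
    using q_poch_inf_fps(1)[OF x] unfolding has_prod_def raw_has_prod_def by auto
  then have lim: "(\<lambda>N. q_poch x fps_X (Suc N)) \<longlonglongrightarrow> q_poch_inf x fps_X"
    by (simp only: q_poch_def lessThan_Suc_atMost)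
  have "fps_nth (q_poch x fps_X n) m = fps_nth (q_poch_inf x fps_X) m" if "m < k" for m
  proof -
    have "\<forall>\<^sub>F N in sequentially. fps_nth (q_poch x fps_X (Suc N)) m = fps_nth (q_poch_inf x fps_X) m"
      using lim unfolding tendsto_fps_iff by blast
    then have "\<forall>\<^sub>F N in sequentially. fps_nth (q_poch x fps_X n) m = fps_nth (q_poch_inf x fps_X) m"
      using eventually_ge_at_top[of n]
    proof eventually_elim
      case (elim N)
      then show ?case using stable[of "Suc N" m] that by simp
    qed
    then show ?thesis by simp
  qed
  then show ?thesis
    by (simp add: fps_X_power_dvd_iff)
qed

text \<open>In the convolution identity with g_n = 1/(q^2;q^2)_n, every term with n \<ge> 1 is
  divisible by X^k, so T_k(0,0) agrees with g_k. The two products multiply to (q^2;q^2)_k.\<close>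

lemma T_gen_zero_cong_q_poch:
  "fps_X ^ k dvd q_poch fps_X fps_X k * q_poch (- fps_X) fps_X k * T_gen fps_X 0 0 k - (1 :: 'a::field fps)"
proof -
  let ?X = "fps_X :: 'a fps"
  define d where "d n = q_poch ?X ?X n * q_poch (- ?X) ?X n" for n
  define g where "g n = inverse (d n)" for n
  have "fps_nth (d n) 0 = 1" for n
    by (simp add: d_def fps_nth_q_poch_0)
  then have dg: "d n * g n = 1" for n
    by (simp add: g_def inverse_mult_eq_1')
  have "g 0 = 1"
    by (simp add: g_def d_def q_poch_def)
  moreover have "(1 - ?X ^ (2 * Suc n)) * g (Suc n) = g n" for n
  proof -
    have "d (Suc n) = d n * (1 - ?X ^ (2 * Suc n))"
      unfolding d_def q_poch_Suc mult_2 power_add by (simp add: algebra_simps)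
    then have "d n * ((1 - ?X ^ (2 * Suc n)) * g (Suc n)) = 1"
      using dg[of "Suc n"] by (simp only: mult_ac)
    then have "d n * ((1 - ?X ^ (2 * Suc n)) * g (Suc n)) = d n * g n"
      by (simp only: dg)
    moreover have "d n \<noteq> 0"
      using dg[of n] by auto
    ultimately show ?thesis
      by (simp only: mult_cancel_left) simp
  qed
  ultimately have "(\<Sum>n\<le>k. ?X ^ (2 * n * (k - n + 1)) * g n * T_gen ?X 0 0 (k - n)) = g k"
    by (rule T_gen_zero_convolution)
  then have "g k - T_gen ?X 0 0 k = (\<Sum>n\<in>{..k} - {0}. ?X ^ (2 * n * (k - n + 1)) * g n * T_gen ?X 0 0 (k - n))"
    using \<open>g 0 = 1\<close> by (simp add: sum.remove[of "{..k}" 0] algebra_simps)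
  also have "?X ^ k dvd \<dots>"
  proof (rule dvd_sum)
    fix n assume n: "n \<in> {..k} - {0}"
    then obtain n' j where "n = Suc n'" "k = n + j"
      by (metis DiffD1 DiffD2 atMost_iff insertI1 le_Suc_ex not0_implies_Suc)
    then have "k \<le> 2 * n * (k - n + 1)"
      by (simp add: algebra_simps)
    then show "?X ^ k dvd ?X ^ (2 * n * (k - n + 1)) * g n * T_gen ?X 0 0 (k - n)"
      by (simp only: mult.assoc le_imp_power_dvd dvd_mult2)
  qed
  finally have "?X ^ k dvd - d k * (g k - T_gen ?X 0 0 k)"
    by (rule dvd_mult)
  also have "- d k * (g k - T_gen ?X 0 0 k) = d k * T_gen ?X 0 0 k - 1"
    using dg[of k] by (simp add: algebra_simps)
  finally show ?thesis
    by (simp add: d_def)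
qed

text \<open>Multiplied by the unit \<open>u\<close>, both sides become \<Phi>^2 modulo X^k: for T
  because \<phi>(a) M(a) = \<phi>(a+k), and likewise for b; for L because \<phi>(a) \<phi>(b) \<Psi>
  L = \<Phi>.\<close>

lemma T_gen_cong_T_limit:
  "fps_X ^ k dvd T_gen fps_X (fps_X ^ a) (fps_X ^ b) k - (T_limit a b :: 'a::field fps)"
proof -
  let ?X = "fps_X :: 'a fps"
  define \<phi> where "\<phi> n = q_poch ?X ?X n" for n
  define \<psi> where "\<psi> n = q_poch (- ?X) ?X n" for n
  define \<Phi> where "\<Phi> = q_poch_inf ?X ?X"
  define \<Psi> where "\<Psi> = q_poch_inf (- ?X) ?X"
  define T where "T = T_gen ?X (?X ^ a) (?X ^ b) k"
  define C where "C = T_gen ?X 0 0 k"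
  define M where "M c = (\<Prod>i<k. 1 - ?X ^ Suc i * ?X ^ c)" for c
  define L where "L = (T_limit a b :: 'a fps)"
  have nth0: "fps_nth (\<phi> n) 0 = 1" "fps_nth (\<psi> n) 0 = 1" "fps_nth \<Psi> 0 = 1" for n
    by (simp_all add: \<phi>_def \<psi>_def \<Psi>_def fps_nth_q_poch_0 q_poch_inf_fps)
  have 1: "?X ^ k dvd T - C * (M a * M b)"
    using T_gen_cong_product[of ?X k "?X ^ a" "?X ^ b"]
    by (simp only: T_def C_def M_def prod.distrib[symmetric]) simp
  have 2: "?X ^ k dvd \<phi> k * \<psi> k * C - 1"
    unfolding \<phi>_def \<psi>_def C_def by (rule T_gen_zero_cong_q_poch)
  have 3: "?X ^ k dvd \<phi> n - \<Phi>" "?X ^ k dvd \<psi> n - \<Psi>" if "k \<le> n" for n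
    unfolding \<phi>_def \<psi>_def \<Phi>_def \<Psi>_def using that by (simp_all add: q_poch_cong_inf)
  have M: "\<phi> c * M c = \<phi> (c + k)" for c
    unfolding M_def \<phi>_def by (induction k) (simp_all add: q_poch_Suc mult_ac power_add)
  have L: "\<phi> a * \<phi> b * \<Psi> * L = \<Phi>"
  proof -
    have "L = inverse (\<phi> a * \<phi> b) * (\<Phi> * inverse \<Psi>)"
      using nth0 by (simp add: L_def T_limit_def \<phi>_def \<Phi>_def \<Psi>_def fps_divide_unit)
    moreover have "\<phi> a * \<phi> b * inverse (\<phi> a * \<phi> b) = 1" "\<Psi> * inverse \<Psi> = 1"
      using nth0 by (auto intro!: inverse_mult_eq_1' simp del: fps_inverse_mult)
    moreover have "\<phi> a * \<phi> b * \<Psi> * (inverse (\<phi> a * \<phi> b) * (\<Phi> * inverse \<Psi>)) =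
        \<Phi> * ((\<phi> a * \<phi> b * inverse (\<phi> a * \<phi> b)) * (\<Psi> * inverse \<Psi>))"
      by (simp only: mult_ac)
    ultimately show ?thesis
      by (simp only: mult_1_right)
  qed
  define u where "u = \<phi> a * \<phi> b * \<phi> k * \<psi> k"
  have "u * (T - L) = u * (T - C * (M a * M b)) + (\<phi> k * \<psi> k * C - 1) * (\<phi> (a + k) * \<phi> (b + k))
      + (\<phi> (a + k) - \<Phi>) * \<phi> (b + k) + \<Phi> * (\<phi> (b + k) - \<Phi>)
      - \<phi> a * \<phi> b * L * ((\<phi> k - \<Phi>) * \<psi> k + \<Phi> * (\<psi> k - \<Psi>))"
  proof -
    have 4: "u * (C * (M a * M b)) = \<phi> k * \<psi> k * C * (\<phi> (a + k) * \<phi> (b + k))"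
      unfolding M[symmetric] u_def by (simp only: mult_ac)
    have 5: "\<phi> a * \<phi> b * L * (\<Phi> * \<Psi>) - \<Phi> * \<Phi> = 0"
      unfolding L[symmetric] by (simp add: mult_ac)
    have 6: "u * L = \<phi> a * \<phi> b * L * (\<phi> k * \<psi> k)"
      by (simp add: u_def mult_ac)
    have "u * (T - L) = u * T - u * L + (\<phi> a * \<phi> b * L * (\<Phi> * \<Psi>) - \<Phi> * \<Phi>)"
      unfolding 5 by (simp add: right_diff_distrib)
    then show ?thesis
      unfolding right_diff_distrib[of u] 4 6 by (simp add: algebra_simps)
  qed
  also have "?X ^ k dvd \<dots>"
    using 1 2 3[of k] 3(1)[of "a + k"] 3(1)[of "b + k"]
    by (intro dvd_diff dvd_add) (simp_all add: dvd_mult dvd_mult2)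
  finally have "?X ^ k dvd u * (T - L)" .
  moreover have "u dvd 1"
    using nth0 by (simp add: u_def)
  ultimately show ?thesis
    unfolding T_def L_def by (simp only: dvd_mult_unit_iff')
qed

section \<open>Continued fraction and ballot numbers\<close>

lemma fps_nth_s_fraction:
  assumes "n \<le> N"
  shows "fps_nth (s_fraction c) n = fps_nth (s_convergent c N) n"
proof -
  have *: "fps_nth (s_convergent c m) n = fps_nth (s_convergent c N) n" if "N \<le> m" for m
    using that assms by (induction m rule: dec_induct) (simp_all del: s_convergent.simps add: s_convergent_stable)
  have "\<forall>\<^sub>F m in sequentially. fps_nth (s_convergent c m) n = fps_nth (s_fraction c) n"
    using s_convergent_tendsto[of c] unfolding tendsto_fps_iff by blast
  then have "\<forall>\<^sub>F m in sequentially. fps_nth (s_convergent c N) n = fps_nth (s_fraction c) n"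
    using eventually_ge_at_top[of N] by eventually_elim (metis *)
  then show ?thesis by simp
qed

lemma s_fraction_nth_0: "fps_nth (s_fraction c) 0 = 1"
  by (simp add: fps_nth_s_fraction[of 0 0])

text \<open>Coefficient form of S = 1 + c_0 z S S', where S' has the shifted coefficients. It is
  read off convergents of depth n + 1 and n, which already agree with the limits in the degrees
  concerned.\<close>

lemma s_fraction_nth_Suc:
  "fps_nth (s_fraction c) (Suc n) =
     c 0 * (\<Sum>i=0..n. fps_nth (s_fraction c) i * fps_nth (s_fraction (\<lambda>i. c (Suc i))) (n - i))"
proof -
  let ?s = "s_convergent c (Suc n)" and ?s' = "s_convergent (\<lambda>i. c (Suc i)) n"
  define d where "d = 1 - fps_const (c 0) * fps_X * ?s'"
  have "fps_nth d 0 \<noteq> 0"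
    by (simp add: d_def mult.assoc)
  then have "?s * d = 1"
    by (simp add: d_def fps_divide_unit inverse_mult_eq_1)
  then have "?s = 1 + fps_const (c 0) * (fps_X * (?s * ?s'))"
    unfolding d_def right_diff_distrib mult_1_right diff_eq_eq by (simp only: mult_ac)
  then have "fps_nth ?s (Suc n) = fps_nth (1 + fps_const (c 0) * (fps_X * (?s * ?s'))) (Suc n)"
    by (rule arg_cong)
  also have "\<dots> = c 0 * fps_nth (?s * ?s') n"
    by (simp del: s_convergent.simps)
  also have "\<dots> = c 0 * (\<Sum>i=0..n. fps_nth (s_fraction c) i * fps_nth (s_fraction (\<lambda>i. c (Suc i))) (n - i))"
    by (simp add: fps_mult_nth fps_nth_s_fraction[of _ "Suc n" c]
        fps_nth_s_fraction[of _ n "\<lambda>i. c (Suc i)"] del: s_convergent.simps)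
  finally show ?thesis
    by (simp add: fps_nth_s_fraction[of "Suc n" "Suc n" c] del: s_convergent.simps)
qed

section \<open>Ballot numbers and their generating function\<close>

definition ballot :: "nat \<Rightarrow> int \<Rightarrow> 'a::comm_ring_1" where
  "ballot n k = of_nat (binom_int (2 * n) (int n - k)) - of_nat (binom_int (2 * n) (int n - k - 1))"

lemma binom_int_Suc: "binom_int (Suc n) j = binom_int n j + binom_int n (j - 1)"
proof (cases "j \<le> 0")
  case True
  then show ?thesis by (cases "j = 0") (auto simp: binom_int_def)
next
  case False
  then obtain m where "j = int (Suc m)"
    by (metis not_le zero_less_imp_eq_int Suc_pred)
  then show ?thesis by (simp add: binom_int_def nat_add_distrib)
qed

lemma ballot_Suc:
  "ballot (Suc n) k = ballot n (k - 1) + 2 * ballot n k + (ballot n (k + 1) :: 'a::comm_ring_1)"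
proof -
  have "binom_int (2 * Suc n) j = binom_int (2 * n) j + 2 * binom_int (2 * n) (j - 1) + binom_int (2 * n) (j - 2)" for j
    using binom_int_Suc[of "Suc (2 * n)" j] binom_int_Suc[of "2 * n" j] binom_int_Suc[of "2 * n" "j - 1"]
    by simp
  then show ?thesis
    by (simp add: ballot_def algebra_simps)
qed

text \<open>Reflection by binomial symmetry. It supplies the boundary value that
  \<open>ballot_Suc\<close> needs at k = 0, which is why the index is an integer.\<close>

lemma ballot_minus_1: "ballot n (-1) = - (ballot n 0 :: 'a::comm_ring_1)"
proof -
  have "binom_int (2 * n) (int n + 1) = binom_int (2 * n) (int n - 1)"
  proof (cases n)
    case (Suc m)
    then show ?thesis
      using binomial_symmetric[of m "2 * n"] by (simp add: binom_int_def nat_add_distrib)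
  qed (simp add: binom_int_def)
  then show ?thesis by (simp add: ballot_def)
qed

lemma ballot_0: "ballot 0 (int k) = (if k = 0 then 1 else 0)"
  by (simp add: ballot_def binom_int_def)

text \<open>The root is the compositional inverse of X / (1 + X)^2.\<close>

lemma fps_quadratic_root_exists:
  "\<exists>w :: 'a::field fps. fps_nth w 0 = 0 \<and> w = fps_X * (1 + w) ^ 2"
proof -
  define v where "v = (1 + fps_X :: 'a fps) ^ 2"
  have v0: "fps_nth v 0 = 1"
    by (simp add: v_def power2_eq_square)
  define g where "g = fps_X * inverse v"
  define w where "w = fps_inv g"
  have "g oo w = fps_X"
    unfolding w_def by (rule fps_inv_right) (simp_all add: g_def v0)
  moreover have w0: "fps_nth w 0 = 0"
    by (simp add: w_def fps_inv_def)
  moreover have "g * v = fps_X"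
    using v0 by (simp add: g_def mult.assoc inverse_mult_eq_1)
  then have "(g oo w) * (v oo w) = w"
    using w0 by (metis fps_compose_mult_distrib fps_X_fps_compose_startby0)
  moreover have "v oo w = (1 + w) ^ 2"
    using w0 by (simp add: v_def fps_compose_power[symmetric] fps_compose_add_distrib)
  ultimately show ?thesis by metis
qed

text \<open>Replacing one factor w by X (1 + w)^2 = X (1 + 2w + w^2) reproduces
  \<open>ballot_Suc\<close>. For k = 0, reflection reduces that recurrence to ballot(n,0) +
  ballot(n,1).\<close>

lemma ballot_generating_function:
  fixes w :: "'a::comm_ring_1 fps"
  assumes w0: "fps_nth w 0 = 0" and w: "w = fps_X * (1 + w) ^ 2"
  shows "fps_nth ((1 + w) * w ^ k) n = ballot n (int k)"
proof (induction n arbitrary: k)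
  case 0
  then show ?case using w0 by (simp add: ballot_0 fps_nth_power_0 power_0_left)
next
  case (Suc n)
  show ?case
  proof (cases k)
    case 0
    have "(1 + w) * w ^ 0 = 1 + fps_X * ((1 + w) * w ^ 0 + (1 + w) * w ^ 1)"
      by (subst (1) w) (simp add: algebra_simps power2_eq_square)
    then have "fps_nth ((1 + w) * w ^ 0) (Suc n) =
        fps_nth (1 + fps_X * ((1 + w) * w ^ 0 + (1 + w) * w ^ 1)) (Suc n)"
      by (rule arg_cong)
    also have "\<dots> = fps_nth ((1 + w) * w ^ 0) n + fps_nth ((1 + w) * w ^ 1) n"
      by (simp only: fps_add_nth fps_X_mult_nth) simp
    finally have "fps_nth ((1 + w) * w ^ 0) (Suc n) =
        fps_nth ((1 + w) * w ^ 0) n + fps_nth ((1 + w) * w ^ 1) n" .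
    then show ?thesis
      using ballot_Suc[of n 0, where 'a = 'a] ballot_minus_1[of n, where 'a = 'a] Suc.IH[of 0] Suc.IH[of 1]
      by (simp only: 0) simp
  next
    case (Suc l)
    have "(1 + w) * w ^ Suc l = (1 + w) * w ^ l * (fps_X * (1 + w) ^ 2)"
      by (subst w[symmetric]) (simp add: algebra_simps)
    also have "\<dots> = fps_X * ((1 + w) * w ^ l + ((1 + w) * w ^ Suc l + (1 + w) * w ^ Suc l) + (1 + w) * w ^ Suc (Suc l))"
      by (simp add: algebra_simps power2_eq_square)
    finally have "fps_nth ((1 + w) * w ^ Suc l) (Suc n) = fps_nth (fps_X * ((1 + w) * w ^ l
        + ((1 + w) * w ^ Suc l + (1 + w) * w ^ Suc l) + (1 + w) * w ^ Suc (Suc l))) (Suc n)"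
      by (rule arg_cong)
    also have "\<dots> = fps_nth ((1 + w) * w ^ l) n
      + (fps_nth ((1 + w) * w ^ Suc l) n + fps_nth ((1 + w) * w ^ Suc l) n) + fps_nth ((1 + w) * w ^ Suc (Suc l)) n"
      by (simp only: fps_add_nth fps_X_mult_nth) simp
    finally have "fps_nth ((1 + w) * w ^ Suc l) (Suc n) = fps_nth ((1 + w) * w ^ l) n
      + (fps_nth ((1 + w) * w ^ Suc l) n + fps_nth ((1 + w) * w ^ Suc l) n) + fps_nth ((1 + w) * w ^ Suc (Suc l)) n" .
    then show ?thesis
      using ballot_Suc[of n "int k", where 'a = 'a] by (simp only: Suc.IH Suc) (simp add: algebra_simps)
  qed
qed

text \<open>Ballot sums become a substitution, which respects products. The sum stops at n because
  w^k has no terms below degree k.\<close>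

lemma ballot_transform:
  fixes w :: "'a::idom fps"
  assumes w0: "fps_nth w 0 = 0" and w: "w = fps_X * (1 + w) ^ 2"
  shows "fps_nth ((1 + w) * (F oo w)) n = (\<Sum>k=0..n. ballot n (int k) * fps_nth F k)"
proof -
  have "fps_nth ((1 + w) * (F oo w)) n =
      (\<Sum>m=0..n. \<Sum>k=0..n. fps_nth F k * (fps_nth (1 + w) m * fps_nth (w ^ k) (n - m)))"
    unfolding fps_mult_nth
  proof (rule sum.cong[OF refl])
    fix m
    have "fps_nth (F oo w) (n - m) = (\<Sum>k=0..n. fps_nth F k * fps_nth (w ^ k) (n - m))"
      unfolding fps_compose_nth
      using startsby_zero_power_prefix[OF w0] by (intro sum.mono_neutral_left) auto
    then show "fps_nth (1 + w) m * fps_nth (F oo w) (n - m) =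
      (\<Sum>k=0..n. fps_nth F k * (fps_nth (1 + w) m * fps_nth (w ^ k) (n - m)))"
      by (simp add: sum_distrib_left mult_ac)
  qed
  also have "\<dots> = (\<Sum>k=0..n. fps_nth F k * fps_nth ((1 + w) * w ^ k) n)"
    by (subst sum.swap) (simp add: fps_mult_nth sum_distrib_left)
  finally show ?thesis
    by (simp add: ballot_generating_function[OF w0 w] mult.commute)
qed

section \<open>The coefficients U_k and the continued fraction\<close>

definition U_coeff :: "nat \<Rightarrow> nat \<Rightarrow> 'a::field \<Rightarrow> nat \<Rightarrow> 'a" where
  "U_coeff a b q k = q ^ (k * (k + 1 + a + b)) * T_gen (1 / q) ((1 / q) ^ a) ((1 / q) ^ b) k"

text \<open>This is the recurrence of \<open>T_gen\<close> at p = 1/q, multiplied by q^N with N the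
  exponent belonging to k + 1. The subtracted term becomes exactly U_k.\<close>

lemma U_coeff_Suc:
  fixes q :: "'a::field"
  assumes "q \<noteq> 0"
  shows "U_coeff a b q (Suc k) + U_coeff a b q k =
    (1 - q ^ Suc a) * (1 - q ^ Suc b) * (\<Sum>i=0..k. U_coeff a b q i * U_coeff (Suc a) (Suc b) q (k - i))"
proof -
  define p where "p = 1 / q"
  define N where "N = Suc k * (Suc k + 1 + a + b)"
  have cancel: "q ^ m * p ^ n = q ^ (m - n)" if "n \<le> m" for m n
    using that assms by (simp add: p_def power_diff power_one_over)
  have U: "U_coeff a b q n = q ^ (n * (n + 1 + a + b)) * T_gen p (p ^ a) (p ^ b) n" for a b n
    by (simp add: U_coeff_def p_def)
  have "q ^ N * (p ^ (2 * k + 2) * p ^ a * p ^ b) = q ^ (N - (2 * k + 2 + a + b))"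
    by (simp only: power_add[symmetric]) (rule cancel, simp add: N_def)
  also have "N - (2 * k + 2 + a + b) = k * (k + 1 + a + b)"
    by (simp add: N_def algebra_simps)
  finally have 1: "q ^ N * (p ^ (2 * k + 2) * p ^ a * p ^ b) = q ^ (k * (k + 1 + a + b))" .
  have 2: "q ^ N * ((1 - p ^ Suc a) * (1 - p ^ Suc b)) * p ^ (2 * i * (k - i + 1)) =
      (1 - q ^ Suc a) * (1 - q ^ Suc b) * (q ^ (i * (i + 1 + a + b)) * q ^ ((k - i) * (k - i + 1 + Suc a + Suc b)))"
    if ik: "i \<le> k" for i
  proof -
    obtain j where j: "k = i + j" using le_Suc_ex[OF ik] by blast
    define d where "d = 2 * i * (k - i + 1)"
    define e where "e = i * (i + 1 + a + b)"
    define f where "f = (k - i) * (k - i + 1 + Suc a + Suc b)"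
    have N: "N = d + (Suc a + Suc b + (e + f))"
      unfolding N_def d_def e_def f_def j by (simp add: algebra_simps)
    have "q ^ N * p ^ d = q ^ (N - d)"
      unfolding N by (rule cancel) simp
    also have "N - d = Suc a + Suc b + (e + f)"
      using N by linarith
    finally have "q ^ N * p ^ d = q ^ Suc a * q ^ Suc b * (q ^ e * q ^ f)"
      by (simp only: power_add)
    \<comment> \<open>The factors for a and b each change sign, so the signs cancel in the
      product.\<close>
    moreover have "q ^ Suc c * (1 - p ^ Suc c) = - (1 - q ^ Suc c)" for c
      using cancel[of "Suc c" "Suc c"] by (simp add: right_diff_distrib)
    then have "(q ^ Suc a * (1 - p ^ Suc a)) * (q ^ Suc b * (1 - p ^ Suc b)) = (1 - q ^ Suc a) * (1 - q ^ Suc b)"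
      by (simp only: minus_mult_minus)
    moreover have "q ^ N * ((1 - p ^ Suc a) * (1 - p ^ Suc b)) * p ^ d =
        (1 - p ^ Suc a) * (1 - p ^ Suc b) * (q ^ N * p ^ d)"
      by (simp only: mult_ac)
    moreover have "(1 - p ^ Suc a) * (1 - p ^ Suc b) * (q ^ Suc a * q ^ Suc b * x) =
        (q ^ Suc a * (1 - p ^ Suc a)) * (q ^ Suc b * (1 - p ^ Suc b)) * x" for x
      by (simp only: mult_ac)
    ultimately show ?thesis
      unfolding d_def[symmetric] e_def[symmetric] f_def[symmetric] by metis
  qed
  have "U_coeff a b q (Suc k) = q ^ N * ((1 - p ^ Suc a) * (1 - p ^ Suc b)) *
      (\<Sum>i\<le>k. p ^ (2 * i * (k - i + 1)) * T_gen p (p ^ a) (p ^ b) i * T_gen p (p ^ Suc a) (p ^ Suc b) (k - i))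
      - q ^ N * (p ^ (2 * k + 2) * p ^ a * p ^ b) * T_gen p (p ^ a) (p ^ b) k"
    by (simp only: U N_def[symmetric] T_gen.simps(2) power_Suc right_diff_distrib[of "q ^ N"] mult.assoc)
  also have "\<dots> = (\<Sum>i\<le>k. (q ^ N * ((1 - p ^ Suc a) * (1 - p ^ Suc b)) * p ^ (2 * i * (k - i + 1))) *
      (T_gen p (p ^ a) (p ^ b) i * T_gen p (p ^ Suc a) (p ^ Suc b) (k - i))) - U_coeff a b q k"
    unfolding 1 U by (simp only: sum_distrib_left mult.assoc)
  also have "(\<Sum>i\<le>k. (q ^ N * ((1 - p ^ Suc a) * (1 - p ^ Suc b)) * p ^ (2 * i * (k - i + 1))) *
      (T_gen p (p ^ a) (p ^ b) i * T_gen p (p ^ Suc a) (p ^ Suc b) (k - i))) =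
    (\<Sum>i\<le>k. (1 - q ^ Suc a) * (1 - q ^ Suc b) * (U_coeff a b q i * U_coeff (Suc a) (Suc b) q (k - i)))"
    by (intro sum.cong refl) (simp only: atMost_iff 2 U, simp only: mult_ac)
  finally show ?thesis
    by (simp only: sum_distrib_left[symmetric] atMost_atLeast0) simp
qed

text \<open>The transform W of the U_k satisfies the functional equation of the continued fraction
  with z rescaled by (1 - q)^2, and that equation determines all coefficients recursively.\<close>

lemma E_ab_eq_ballot_sum:
  fixes q :: "'a::field"
  assumes "q \<noteq> 0" "q \<noteq> 1"
  shows "(1 - q) ^ (2 * n) * E_ab a b n q = (\<Sum>k=0..n. ballot n (int k) * U_coeff a b q k)"
proof -
  obtain w :: "'a fps" where w0: "fps_nth w 0 = 0" and w: "w = fps_X * (1 + w) ^ 2"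
    using fps_quadratic_root_exists by blast
  define F where "F a b = Abs_fps (U_coeff a b q)" for a b
  define W where "W a b = (1 + w) * (F a b oo w)" for a b
  have W_nth: "fps_nth (W a b) n = (\<Sum>k=0..n. ballot n (int k) * U_coeff a b q k)" for a b n
    unfolding W_def ballot_transform[OF w0 w] by (simp add: F_def)
  have W_rec: "W a b = 1 + fps_const ((1 - q ^ Suc a) * (1 - q ^ Suc b)) * (fps_X * (W a b * W (Suc a) (Suc b)))" for a b
  proof -
    let ?c = "fps_const ((1 - q ^ Suc a) * (1 - q ^ Suc b))"
    have "(1 + fps_X) * F a b = 1 + ?c * (fps_X * (F a b * F (Suc a) (Suc b)))"
    proof (rule fps_ext)
      fix n
      have "fps_nth (F a b * F (Suc a) (Suc b)) m = (\<Sum>i=0..m. U_coeff a b q i * U_coeff (Suc a) (Suc b) q (m - i))" for m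
        by (simp add: F_def fps_mult_nth)
      moreover have "fps_nth (F a b) 0 = 1"
        by (simp add: F_def U_coeff_def)
      moreover have "fps_nth (F a b) (Suc m) + fps_nth (F a b) m =
          (1 - q ^ Suc a) * (1 - q ^ Suc b) * (\<Sum>i=0..m. U_coeff a b q i * U_coeff (Suc a) (Suc b) q (m - i))" for m
        using U_coeff_Suc[OF assms(1)] by (simp add: F_def)
      ultimately show "fps_nth ((1 + fps_X) * F a b) n = fps_nth (1 + ?c * (fps_X * (F a b * F (Suc a) (Suc b)))) n"
        by (cases n) (simp_all add: distrib_right)
    qed
    then have "((1 + fps_X) * F a b) oo w = (1 + ?c * (fps_X * (F a b * F (Suc a) (Suc b)))) oo w"
      by (rule arg_cong)
    then have "W a b = 1 + ?c * (w * ((F a b oo w) * (F (Suc a) (Suc b) oo w)))"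
      unfolding W_def using w0 by (simp add: fps_compose_mult_distrib fps_compose_add_distrib)
    \<comment> \<open>Writing w = X (1 + w)^2 gives one factor 1 + w to each of the two
      series.\<close>
    also have "w * ((F a b oo w) * (F (Suc a) (Suc b) oo w)) = fps_X * (W a b * W (Suc a) (Suc b))"
      unfolding W_def by (subst w) (simp add: power2_eq_square mult_ac)
    finally show ?thesis .
  qed
  have "(1 - q) ^ (2 * n) * E_ab a b n q = fps_nth (W a b) n" for a b n
  proof (induction n arbitrary: a b rule: less_induct)
    case (less n)
    show ?case
    proof (cases n)
      case 0
      then show ?thesis
        by (subst W_rec) (simp add: E_ab_def s_fraction_nth_0)
    next
      case (Suc m)
      have "E_ab a b n q = q_int (Suc a) q * q_int (Suc b) q * (\<Sum>i=0..m. E_ab a b i q * E_ab (Suc a) (Suc b) (m - i) q)"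
        by (simp add: Suc E_ab_def s_fraction_nth_Suc)
      moreover have "(1 - q) ^ 2 * (q_int (Suc a) q * q_int (Suc b) q) = (1 - q ^ Suc a) * (1 - q ^ Suc b)"
        using assms by (simp add: q_int_def power2_eq_square)
      moreover have "(1 - q) ^ (2 * n) = (1 - q) ^ (2 * m) * (1 - q) ^ 2"
        by (simp add: Suc power_add power2_eq_square)
      moreover have "x * y * (z * s) = y * z * (x * s)" for x y z s :: 'a
        by (simp only: mult_ac)
      ultimately have "(1 - q) ^ (2 * n) * E_ab a b n q =
          (1 - q ^ Suc a) * (1 - q ^ Suc b) * ((1 - q) ^ (2 * m) * (\<Sum>i=0..m. E_ab a b i q * E_ab (Suc a) (Suc b) (m - i) q))"
        by (simp only:)
      also have "(1 - q) ^ (2 * m) * (\<Sum>i=0..m. E_ab a b i q * E_ab (Suc a) (Suc b) (m - i) q) =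
          (\<Sum>i=0..m. fps_nth (W a b) i * fps_nth (W (Suc a) (Suc b)) (m - i))"
        unfolding sum_distrib_left
      proof (rule sum.cong[OF refl])
        fix i assume "i \<in> {0..m}"
        then have i: "i < n" "m - i < n" "2 * m = 2 * i + 2 * (m - i)" using Suc by auto
        show "(1 - q) ^ (2 * m) * (E_ab a b i q * E_ab (Suc a) (Suc b) (m - i) q) =
            fps_nth (W a b) i * fps_nth (W (Suc a) (Suc b)) (m - i)"
          unfolding less.IH[OF i(1), symmetric] less.IH[OF i(2), symmetric] i(3) power_add
          by (simp only: mult_ac)
      qed
      also have "(1 - q ^ Suc a) * (1 - q ^ Suc b) * \<dots> = fps_nth (W a b) n"
      proof -
        have "fps_nth (W a b) n = fps_nth (1 + fps_const ((1 - q ^ Suc a) * (1 - q ^ Suc b)) *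
            (fps_X * (W a b * W (Suc a) (Suc b)))) n"
          by (rule arg_cong[OF W_rec])
        also have "\<dots> = (1 - q ^ Suc a) * (1 - q ^ Suc b) * fps_nth (W a b * W (Suc a) (Suc b)) m"
          by (simp add: Suc)
        finally show ?thesis
          by (simp only: fps_mult_nth)
      qed
      finally show ?thesis .
    qed
  qed
  then show ?thesis
    by (simp add: W_nth)
qed

section \<open>The family of polynomials\<close>

text \<open>This yields existence and uniqueness together: for each q the ballot matrix is lower
  triangular with unit diagonal, so the expansion of the E_n forces the coefficients to be
  U_k.\<close>

lemma T_family_iff:
  fixes T :: "nat \<Rightarrow> 'a::field_char_0 \<Rightarrow> 'a"
  shows "T_family a b T \<longleftrightarrow> (\<forall>k. T k \<in> extensional (- {0, 1})) \<and>
    (\<forall>q \<in> - {0, 1}. \<forall>k. T k q = T_gen q (q ^ a) (q ^ b) k)"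
    (is "_ \<longleftrightarrow> ?ext \<and> ?eq")
proof -
  define V where "V q k = q ^ (k * (k + 1 + a + b)) * T k (1 / q)" for q k
  have "T_family a b T \<longleftrightarrow> ?ext \<and>
    (\<forall>n. \<forall>q \<in> - {0, 1}. E_ab a b n q = 1 / (1 - q) ^ (2 * n) * (\<Sum>k=0..n. ballot n (int k) * V q k))"
    by (simp only: T_family_def ballot_def V_def mult.assoc)
  also have "\<dots> \<longleftrightarrow> ?ext \<and>
    (\<forall>q \<in> - {0, 1}. \<forall>n. (\<Sum>k=0..n. ballot n (int k) * V q k) = (\<Sum>k=0..n. ballot n (int k) * U_coeff a b q k))"
  proof -
    have "E_ab a b n q = 1 / (1 - q) ^ (2 * n) * S \<longleftrightarrow> S = (\<Sum>k=0..n. ballot n (int k) * U_coeff a b q k)"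
      if "q \<in> - {0, 1}" for n q S
    proof -
      have "(1 - q) ^ (2 * n) \<noteq> 0" using that by simp
      then have "E_ab a b n q = 1 / (1 - q) ^ (2 * n) * S \<longleftrightarrow> S = (1 - q) ^ (2 * n) * E_ab a b n q"
        by (simp only: mult.commute[of "1 / _"] times_divide_eq_right mult_1_right eq_divide_eq)
          (auto simp: mult.commute)
      then show ?thesis
        using that by (simp add: E_ab_eq_ballot_sum)
    qed
    then show ?thesis by blast
  qed
  also have "\<dots> \<longleftrightarrow> ?ext \<and> (\<forall>q \<in> - {0, 1}. \<forall>k. V q k = U_coeff a b q k)"
  proof -
    have "f k = g k" if "\<And>n. (\<Sum>k=0..n. ballot n (int k) * f k) = (\<Sum>k=0..n. ballot n (int k) * g k)"
      for f g :: "nat \<Rightarrow> 'a" and k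
    proof (induction k rule: less_induct)
      case (less k)
      have "(\<Sum>i=0..<k. ballot k (int i) * f i) = (\<Sum>i=0..<k. ballot k (int i) * g i)"
        by (intro sum.cong refl) (simp add: less)
      moreover have "ballot k (int k) = (1 :: 'a)"
        by (simp add: ballot_def binom_int_def)
      moreover have "{0..k} = insert k {0..<k}"
        by auto
      ultimately show ?case
        using that[of k] by simp
    qed
    then have "(\<forall>n. (\<Sum>k=0..n. ballot n (int k) * V q k) = (\<Sum>k=0..n. ballot n (int k) * U_coeff a b q k))
        \<longleftrightarrow> (\<forall>k. V q k = U_coeff a b q k)" for q
      by auto
    then show ?thesis by simp
  qed
  also have "\<dots> \<longleftrightarrow> ?ext \<and> (\<forall>q \<in> - {0, 1}. \<forall>k. T k (1 / q) = T_gen (1 / q) ((1 / q) ^ a) ((1 / q) ^ b) k)"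
    by (simp add: V_def U_coeff_def)
  also have "\<dots> \<longleftrightarrow> ?ext \<and> ?eq"
  proof -
    \<comment> \<open>Inversion is an involution of the domain, so a statement about all 1/q is one
      about all q.\<close>
    have "1 / q \<in> - {0, 1} \<and> 1 / (1 / q) = q" if "q \<in> - {0, 1}" for q :: 'a
      using that by auto
    then have "(\<forall>q \<in> - {0, 1 :: 'a}. R (1 / q)) \<longleftrightarrow> (\<forall>q \<in> - {0, 1}. R q)" for R
      by metis
    from this[of "\<lambda>q. \<forall>k. T k q = T_gen q (q ^ a) (q ^ b) k"] show ?thesis by (simp only:)
  qed
  finally show ?thesis .
qed

theorem theorem5p5:
  fixes a b :: nat
  shows "(\<exists>!T :: nat \<Rightarrow> 'a::field_char_0 \<Rightarrow> 'a. T_family a b T) \<and>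
    (\<forall>T :: nat \<Rightarrow> 'a \<Rightarrow> 'a. T_family a b T \<longrightarrow>
      (\<exists>P :: nat \<Rightarrow> 'a poly.
        (\<forall>k. \<forall>q \<in> - {0, 1}. T k q = poly (P k) q) \<and>
        (\<forall>k. fps_X ^ k dvd (fps_of_poly (P k) - T_limit a b)) \<and>
        (\<lambda>k. fps_of_poly (P k)) \<longlonglongrightarrow> T_limit a b))"
proof (intro conjI allI impI)
  show "\<exists>!T :: nat \<Rightarrow> 'a \<Rightarrow> 'a. T_family a b T"
  proof (rule ex1I)
    show "T_family a b (\<lambda>k. \<lambda>q\<in>- {0, 1 :: 'a}. T_gen q (q ^ a) (q ^ b) k)"
      unfolding T_family_iff by simp
  next
    fix T :: "nat \<Rightarrow> 'a \<Rightarrow> 'a"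
    assume T: "T_family a b T"
    show "T = (\<lambda>k. \<lambda>q\<in>- {0, 1}. T_gen q (q ^ a) (q ^ b) k)"
    proof (rule ext)
      fix k
      show "T k = (\<lambda>q\<in>- {0, 1}. T_gen q (q ^ a) (q ^ b) k)"
        by (rule extensionalityI[of _ "- {0, 1}"]) (use T in \<open>simp_all add: T_family_iff\<close>)
    qed
  qed
next
  fix T :: "nat \<Rightarrow> 'a \<Rightarrow> 'a"
  assume T: "T_family a b T"
  \<comment> \<open>Running the recursion on the polynomial variable gives a single P_k whose
    evaluations are the values of T_k and whose power series is the one compared with the
    limit.\<close>
  define P where "P = T_gen [:0, 1 :: 'a:] ([:0, 1:] ^ a) ([:0, 1:] ^ b)"
  have "poly (P k) q = T_gen q (q ^ a) (q ^ b) k" for k q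
    using T_gen_hom[of "\<lambda>p. poly p q" "[:0, 1:]" "[:0, 1:] ^ a" "[:0, 1:] ^ b" k] by (simp add: P_def)
  then have T_eq: "\<forall>k. \<forall>q \<in> - {0, 1}. T k q = poly (P k) q"
    using T by (simp add: T_family_iff)
  have "fps_of_poly (P k) = T_gen fps_X (fps_X ^ a) (fps_X ^ b) k" for k
    using T_gen_hom[of fps_of_poly "[:0, 1 :: 'a:]" "[:0, 1:] ^ a" "[:0, 1:] ^ b" k]
    by (simp add: P_def fps_of_poly_diff fps_of_poly_mult fps_of_poly_power)
  then have cong: "fps_X ^ k dvd (fps_of_poly (P k) - T_limit a b)" for k
    by (simp add: T_gen_cong_T_limit)
  have "(\<lambda>k. fps_of_poly (P k)) \<longlonglongrightarrow> T_limit a b"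
  proof (rule tendsto_fpsI)
    fix n
    show "\<forall>\<^sub>F k in sequentially. fps_nth (fps_of_poly (P k)) n = fps_nth (T_limit a b) n"
      using eventually_gt_at_top[of n]
    proof eventually_elim
      case (elim k)
      then show ?case using cong[of k] by (simp add: fps_X_power_dvd_iff)
    qed
  qed
  with T_eq cong show "\<exists>P :: nat \<Rightarrow> 'a poly.
        (\<forall>k. \<forall>q \<in> - {0, 1}. T k q = poly (P k) q) \<and>
        (\<forall>k. fps_X ^ k dvd (fps_of_poly (P k) - T_limit a b)) \<and>
        (\<lambda>k. fps_of_poly (P k)) \<longlonglongrightarrow> T_limit a b"
    by blast
qed

end
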